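(* Let $q$ be a prime power and let $\mathbb{F}_q$ be the finite field of order $q$. There exist orthomorphism polynomials $f,g \in \mathbb{F}_q[x]$ that satisfy $H(f,g)=3$ if and only if $q \notin \{2,5,8\}$.
   Context: A polynomial $f \in \mathbb{F}_q[x]$ is a permutation polynomial if the map $x \mapsto f(x)$ is a permutation of $\mathbb{F}_q$. A permutation polynomial $f \in \mathbb{F}_q[x]$ is an orthomorphism polynomial if the map $x \mapsto f(x)-x$ is also a permutation of $\mathbb{F}_q$. The Hamming distance between $f,g \in \mathbb{F}_q[x]$ is $H(f,g)=\big|\{a \in \mathbb{F}_q : f(a) \neq g(a)\}\big|$. *)

theory Defs
  imports "HOL-Computational_Algebra.Polynomial" "HOL-Number_Theory.Prime_Powers"
    "HOL-Library.Cardinality"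
begin

definition permutation_poly :: "'a::{field,finite} poly \<Rightarrow> bool" where
  "permutation_poly f \<longleftrightarrow> bij (\<lambda>x. poly f x)"

definition orthomorphism_poly :: "'a::{field,finite} poly \<Rightarrow> bool" where
  "orthomorphism_poly f \<longleftrightarrow> permutation_poly f \<and> bij (\<lambda>x. poly f x - x)"

text \<open>The polynomials are compared as functions, so two distinct polynomials
  may have distance 0.\<close>

definition hamming_dist :: "'a::{field,finite} poly \<Rightarrow> 'a poly \<Rightarrow> nat" where
  "hamming_dist f g = card {a. poly f a \<noteq> poly g a}"

end

theory Submission
  imports Defs "HOL-Number_Theory.Residues" "HOL-Library.Z2"
begin

text \<open>Two orthomorphisms at distance three differ by a cyclic shift of their values on three points
  \<open>a, b, c\<close>, and the differences \<open>\<theta> x - x\<close> are shifted the other way. So such a pair exists iff some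
  orthomorphism \<open>\<theta>\<close> satisfies \<open>\<theta> b = \<theta> a + b - c\<close> and \<open>\<theta> c = \<theta> a + b - a\<close>. This condition involves only
  addition, so \<open>\<theta>\<close> may be taken linear over the prime field \<open>\<bbbF>\<^sub>p\<close> when \<open>p = 2\<close>, and assembled from
  cosets of a subgroup of order \<open>p\<^sup>2\<close> when \<open>p\<close> is odd and \<open>q \<noteq> p\<close>. For primes \<open>q = p\<close>, multiplication by
  \<open>1 - t\<close> with \<open>t\<^sup>2 - t + 1 = 0\<close> works if \<open>p \<equiv> 1\<close> modulo \<open>3\<close>, a quadratic orthomorphism works if
  \<open>p \<equiv> 3\<close> modulo \<open>4\<close>, and in the remaining classes \<open>5\<close> and \<open>17\<close> modulo \<open>24\<close> a starter read off a (hooked)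
  Skolem sequence works.\<close>

section \<open>Orthomorphisms at distance three\<close>

definition orthomorphism :: "('a::ab_group_add \<Rightarrow> 'a) \<Rightarrow> bool" where
  "orthomorphism \<theta> \<longleftrightarrow> bij \<theta> \<and> bij (\<lambda>x. \<theta> x - x)"

text \<open>The equations read \<open>\<theta> b - b = \<theta> a - c\<close> and
  \<open>\<theta> c - b = \<theta> a - a\<close>, and they imply
  \<open>\<theta> c - c = \<theta> b - a\<close>. So shifting the values along
  \<open>a, b, c\<close> permutes the three differences.\<close>

definition switchable :: "('a::ab_group_add \<Rightarrow> 'a) \<Rightarrow> 'a \<Rightarrow> 'a \<Rightarrow> 'a \<Rightarrow> bool" where
  "switchable \<theta> a b c \<longleftrightarrow> orthomorphism \<theta> \<and> a \<noteq> b \<and> b \<noteq> c \<and> a \<noteq> c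
     \<and> \<theta> b = \<theta> a + b - c \<and> \<theta> c = \<theta> a + b - a"

lemma orthomorphismI:
  fixes \<theta> :: "'a::{ab_group_add,finite} \<Rightarrow> 'a"
  assumes "\<And>x y. \<theta> x = \<theta> y \<Longrightarrow> x = y" and "\<And>x y. \<theta> x - x = \<theta> y - y \<Longrightarrow> x = y"
  shows "orthomorphism \<theta>"
  unfolding orthomorphism_def
  by (intro conjI finite_UNIV_inj_surj bijI finite_UNIV_inj_surj injI)
     (auto intro: assms finite_UNIV_inj_surj simp: inj_def)

lemma orthomorphismD:
  assumes "orthomorphism \<theta>"
  shows "\<theta> x = \<theta> y \<longleftrightarrow> x = y" and "\<theta> x - x = \<theta> y - y \<longleftrightarrow> x = y"
  using assms unfolding orthomorphism_def bij_def inj_def by blast+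

text \<open>Translations are bijections, and the equations involve only differences. This prepares
  the impossibility proofs.\<close>

lemma switchable_normalize:
  assumes "switchable \<theta> a b c"
  shows "switchable (\<lambda>x. \<theta> (x + a) - \<theta> a) 0 (b - a) (c - a)"
proof -
  have o: "orthomorphism \<theta>" using assms by (simp add: switchable_def)
  have 1: "bij (\<lambda>x::'a. x + d)" for d by (rule bij_plus_right)
  have "bij ((\<lambda>x. x + (- \<theta> a)) \<circ> \<theta> \<circ> (\<lambda>x. x + a))"
    using o by (intro bij_comp 1) (auto simp: orthomorphism_def)
  moreover have "bij ((\<lambda>x. x + (a - \<theta> a)) \<circ> (\<lambda>x. \<theta> x - x) \<circ> (\<lambda>x. x + a))"
    using o by (intro bij_comp 1) (auto simp: orthomorphism_def)
  ultimately show ?thesis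
    using assms by (auto simp: switchable_def orthomorphism_def o_def algebra_simps)
qed

lemma switch:
  fixes \<theta> :: "'a::{ab_group_add,finite} \<Rightarrow> 'a"
  assumes "switchable \<theta> a b c"
  obtains \<eta> where "orthomorphism \<eta>" and "{x. \<theta> x \<noteq> \<eta> x} = {a, b, c}"
proof -
  have o: "orthomorphism \<theta>" and d: "a \<noteq> b" "b \<noteq> c" "a \<noteq> c"
    and v: "\<theta> b = \<theta> a + b - c" "\<theta> c = \<theta> a + b - a"
    using assms by (auto simp: switchable_def)
  \<comment> \<open>\<open>\<delta>\<close> is the inverse cycle of \<open>\<rho>\<close>. The
    switched map is \<open>\<theta> (\<rho> x)\<close>, and its differences are those of
    \<open>\<theta>\<close> permuted by \<open>\<delta>\<close>.\<close>
  define \<rho> \<delta> where "\<rho> = id(a := b, b := c, c := a)" and "\<delta> = id(a := c, b := a, c := b)"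
  have inj: "inj \<rho>" "inj \<delta>"
    using d by (auto simp: \<rho>_def \<delta>_def inj_def)
  have eq: "\<theta> (\<rho> x) - x = \<theta> (\<delta> x) - \<delta> x" for x
    using d v by (auto simp: \<rho>_def \<delta>_def algebra_simps)
  have "orthomorphism (\<lambda>x. \<theta> (\<rho> x))"
    by (rule orthomorphismI) (simp_all add: eq orthomorphismD[OF o] inj_eq[OF inj(1)] inj_eq[OF inj(2)])
  moreover have "{x. \<theta> x \<noteq> \<theta> (\<rho> x)} = {a, b, c}"
    using d by (auto simp: orthomorphismD[OF o] \<rho>_def)
  ultimately show thesis by (rule that)
qed

text \<open>On the disagreement set \<open>g\<close> permutes the values of \<open>f\<close> without
  fixed points, hence cyclically. The same holds for the differences, whose cycle must run the
  opposite way.\<close>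

lemma distance_3_imp_switchable:
  fixes f g :: "'a::{ab_group_add,finite} \<Rightarrow> 'a"
  assumes f: "orthomorphism f" and g: "orthomorphism g" and 3: "card {x. f x \<noteq> g x} = 3"
  obtains a b c where "switchable f a b c"
proof -
  obtain a b c where D: "{x. f x \<noteq> g x} = {a, b, c}" and d: "a \<noteq> b" "b \<noteq> c" "a \<noteq> c"
    using 3 by (auto simp: card_3_iff)
  have *: "\<exists>y\<in>{a, b, c} - {x}. h y = k x"
    if x: "x \<in> {a, b, c}" and h: "bij h" and k: "bij k" and hk: "{x. h x \<noteq> k x} = {a, b, c}"
    for x and h k :: "'a \<Rightarrow> 'a"
  proof -
    obtain y where y: "h y = k x" using h by (metis bij_pointE)
    have "y \<noteq> x" using x hk y by auto
    hence "h y \<noteq> k y" using y k by (metis bij_def inj_eq)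
    thus ?thesis using hk y \<open>y \<noteq> x\<close> by auto
  qed
  have D': "{x. f x - x \<noteq> g x - x} = {a, b, c}" using D by auto
  have 1: "\<exists>y\<in>{a, b, c} - {x}. f y = g x" if "x \<in> {a, b, c}" for x
    using *[OF that _ _ D] f g by (auto simp: orthomorphism_def)
  have 2: "\<exists>y\<in>{a, b, c} - {x}. f y - y = g x - x" if "x \<in> {a, b, c}" for x
    using *[OF that _ _ D'] f g by (auto simp: orthomorphism_def)
  note result = that
  have cyc: thesis
    if d: "u \<noteq> v" "v \<noteq> w" "u \<noteq> w" and S: "{a, b, c} = {u, v, w}"
      and e: "g u = f v" "g v = f w" "g w = f u" for u v w
  proof (rule result)
    have "f w - w = f v - u"
      using 2[of u] d e unfolding S by auto
    moreover have "f v - v = f u - w"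
      using 2[of w] d e unfolding S by auto
    moreover have "f u - u = f w - v"
      using 2[of v] d e unfolding S by auto
    ultimately show "switchable f u v w"
      using f d by (simp add: switchable_def algebra_simps) 
  qed
  have ga: "g a = f b \<or> g a = f c" and gb: "g b = f a \<or> g b = f c" and gc: "g c = f a \<or> g c = f b"
    using 1[of a] 1[of b] 1[of c] d by auto
  have n: "g a \<noteq> g b" "g b \<noteq> g c" "g a \<noteq> g c" using d by (simp_all add: orthomorphismD[OF g])
  have "g a = f b \<and> g b = f c \<and> g c = f a \<or> g a = f c \<and> g c = f b \<and> g b = f a"
    using ga gb gc n by metis
  thus thesis
    using cyc[of a b c] cyc[of a c b] d by blast
qed

section \<open>Functions and polynomials on finite fields\<close>

text \<open>Lagrange interpolation with every field element as a node.\<close>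

lemma ex_poly_eq_on_finite_field:
  fixes h :: "'a::{field,finite} \<Rightarrow> 'a"
  obtains f where "\<And>x. poly f x = h x"
proof
  define w where "w a = (\<Prod>b\<in>UNIV - {a}. [:- b, 1:])" for a :: 'a
  define f where "f = (\<Sum>a\<in>UNIV. Polynomial.smult (h a / poly (w a) a) (w a))"
  have w: "poly (w a) x = 0 \<longleftrightarrow> x \<noteq> a" for a x
    by (auto simp: w_def poly_prod)
  show "poly f x = h x" for x
  proof -
    have "poly f x = (\<Sum>a\<in>UNIV. h a / poly (w a) a * poly (w a) x)"
      by (simp add: f_def poly_sum)
    also have "\<dots> = (\<Sum>a\<in>UNIV. if a = x then h x else 0)"
      using w by (intro sum.cong) auto
    finally show ?thesis by simp
  qed
qed

lemma orthomorphism_poly_iff: "orthomorphism_poly f \<longleftrightarrow> orthomorphism (poly f)"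
  by (simp add: orthomorphism_poly_def permutation_poly_def orthomorphism_def)

lemma distance_3_iff_switchable:
  "(\<exists>f g :: 'a::{field,finite} poly.
      orthomorphism_poly f \<and> orthomorphism_poly g \<and> hamming_dist f g = 3)
    \<longleftrightarrow> (\<exists>\<theta> (a::'a) b c. switchable \<theta> a b c)"
proof
  assume "\<exists>\<theta> (a::'a) b c. switchable \<theta> a b c"
  then obtain \<theta> and a b c :: 'a where s: "switchable \<theta> a b c" by blast
  then obtain \<eta> where \<eta>: "orthomorphism \<eta>" "{x. \<theta> x \<noteq> \<eta> x} = {a, b, c}" by (rule switch)
  obtain f g where fg: "\<And>x. poly f x = \<theta> x" "\<And>x. poly g x = \<eta> x"
    using ex_poly_eq_on_finite_field by metis
  have "poly f = \<theta>" "poly g = \<eta>" using fg by auto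
  hence "orthomorphism_poly f \<and> orthomorphism_poly g \<and> hamming_dist f g = 3"
    using s \<eta> by (auto simp: orthomorphism_poly_iff hamming_dist_def switchable_def)
  thus "\<exists>f g :: 'a poly. orthomorphism_poly f \<and> orthomorphism_poly g \<and> hamming_dist f g = 3"
    by blast
next
  assume "\<exists>f g :: 'a poly. orthomorphism_poly f \<and> orthomorphism_poly g \<and> hamming_dist f g = 3"
  thus "\<exists>\<theta> (a::'a) b c. switchable \<theta> a b c"
    unfolding orthomorphism_poly_iff hamming_dist_def
    by (metis distance_3_imp_switchable)
qed

text \<open>Multiplication by \<open>x\<close> permutes the nonzero elements, so it leaves their
  product unchanged.\<close>

lemma power_CARD_minus_one:
  fixes x :: "'a::{field,finite}"
  assumes "x \<noteq> 0"
  shows "x ^ (CARD('a) - 1) = 1"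
proof -
  have "bij_betw ((*) x) (UNIV - {0}) (UNIV - {0})"
    by (rule bij_betwI[where g = "\<lambda>y. y / x"]) (use assms in auto)
  hence "(\<Prod>y\<in>UNIV - {0}. y) = (\<Prod>y\<in>UNIV - {0}. x * y)"
    by (rule prod.reindex_bij_betw[symmetric])
  also have "\<dots> = x ^ (CARD('a) - 1) * (\<Prod>y\<in>UNIV - {0}. y)"
    by (simp add: prod.distrib card_Diff_singleton)
  finally show ?thesis by simp
qed

lemma prime_CHAR: "prime CHAR('a::{field,finite})"
  by (rule prime_CHAR_semidom) (simp add: finite_imp_CHAR_pos)

lemma int_dvd_small: "n dvd d \<Longrightarrow> \<bar>d\<bar> < n \<Longrightarrow> d = 0" for n d :: int
  by (metis abs_ge_self abs_ge_zero dvd_imp_le_int linorder_not_less order_trans order_less_le_trans)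

text \<open>Equality of images is congruence modulo \<open>CARD('a)\<close>. The start
  \<open>l\<close> is free because differences need a symmetric window and starter positions
  another.\<close>

lemma bij_betw_of_int_interval:
  assumes "CHAR('a::{field,finite}) = CARD('a)"
  shows "bij_betw of_int {l..<l + int CARD('a)} (UNIV :: 'a set)"
proof -
  have inj: "inj_on (of_int :: int \<Rightarrow> 'a) {l..<l + int CARD('a)}"
  proof (rule inj_onI)
    fix x y assume xy: "x \<in> {l..<l + int CARD('a)}" "y \<in> {l..<l + int CARD('a)}"
    assume "(of_int x :: 'a) = of_int y"
    hence "int CARD('a) dvd x - y"
      by (simp add: of_int_eq_iff_cong_CHAR cong_iff_dvd_diff assms)
    moreover have "\<bar>x - y\<bar> < int CARD('a)" using xy by auto
    ultimately show "x = y" using int_dvd_small by fastforce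
  qed
  moreover from inj have "card ((of_int :: int \<Rightarrow> 'a) ` {l..<l + int CARD('a)}) = CARD('a)"
    by (simp add: card_image)
  hence "(of_int :: int \<Rightarrow> 'a) ` {l..<l + int CARD('a)} = UNIV"
    by (intro card_eq_UNIV_imp_eq_UNIV) auto
  ultimately show ?thesis by (simp add: bij_betw_def)
qed

section \<open>Linear and quadratic orthomorphisms\<close>

text \<open>For \<open>\<theta> x = k * x\<close> and the points \<open>0, 1, t\<close>, the two
  equations become \<open>k = 1 - t\<close> and \<open>k * t = 1\<close>.\<close>

lemma switchable_linear:
  fixes t :: "'a::{field,finite}"
  assumes "t\<^sup>2 - t + 1 = 0"
  shows "switchable (\<lambda>x. (1 - t) * x) 0 1 t"
proof -
  have t: "t \<noteq> 0" "t \<noteq> 1" using assms by auto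
  have "orthomorphism (\<lambda>x. (1 - t) * x)"
  proof (rule orthomorphismI)
    show "x = y" if "(1 - t) * x = (1 - t) * y" for x y
      using that t by simp
    show "x = y" if "(1 - t) * x - x = (1 - t) * y - y" for x y
      using that t by (simp add: left_diff_distrib)
  qed
  thus ?thesis using t assms by (auto simp: switchable_def algebra_simps power2_eq_square)
qed

text \<open>A cube root of unity \<open>w \<noteq> 1\<close> gives the root \<open>- w\<close> of
  \<open>t\<^sup>2 - t + 1\<close>. It arises as \<open>x ^ m\<close>, since
  \<open>x ^ m = 1\<close> has at most \<open>m\<close> solutions among the \<open>3 * m\<close>
  nonzero elements.\<close>

lemma ex_switchable_1_mod_3:
  assumes "CARD('a::{field,finite}) mod 3 = 1"
  shows "\<exists>\<theta> (a::'a) b c. switchable \<theta> a b c"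
proof -
  define m where "m = CARD('a) div 3"
  have card: "CARD('a) = 3 * m + 1" using assms unfolding m_def by presburger
  have "card {0, 1::'a} \<le> CARD('a)" by (rule card_mono) auto
  hence m: "m > 0" using card by simp
  have "\<exists>x::'a. x \<noteq> 0 \<and> x ^ m \<noteq> 1"
  proof (rule ccontr)
    assume "\<not> ?thesis"
    hence "UNIV - {0} \<subseteq> {x::'a. x ^ m = 1}" by auto
    hence "card (UNIV - {0::'a}) \<le> card {x::'a. x ^ m = 1}" by (intro card_mono) auto
    also have "{x::'a. x ^ m = 1} = {x. poly (Polynomial.monom 1 m - 1) x = 0}"
      by (simp add: poly_monom)
    also have "card \<dots> \<le> degree (Polynomial.monom 1 m - 1 :: 'a poly)"
      using m by (intro card_poly_roots_bound) (metis (no_types, lifting) degree_1 degree_monom_eq eq_iff_diff_eq_0 less_irrefl one_neq_zero)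
    also have "\<dots> \<le> m" by (rule degree_diff_le) (simp_all add: degree_monom_le)
    finally show False using card m by (simp add: card_Diff_singleton)
  qed
  then obtain x :: 'a where x: "x \<noteq> 0" "x ^ m \<noteq> 1" by blast
  define w where "w = x ^ m"
  have "w ^ 3 = 1"
    using power_CARD_minus_one[OF x(1)] card by (simp add: w_def power_mult[symmetric] mult.commute)
  hence "(w - 1) * (w\<^sup>2 + w + 1) = 0" by (simp add: algebra_simps power2_eq_square power3_eq_cube)
  hence "(- w)\<^sup>2 - (- w) + 1 = 0" using x by (simp add: w_def)
  from switchable_linear[OF this] show ?thesis by blast
qed

text \<open>A quadratic orthomorphism \<open>x \<mapsto> A x\<close> on squares, \<open>x \<mapsto> B x\<close> on nonsquares. The values
  prescribed at \<open>1\<close> and \<open>t\<close> force \<open>A = 1 - t\<close> and \<open>B = 1 / t\<close>, and then both \<open>A B\<close> and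
  \<open>(A - 1) (B - 1)\<close> are squares because \<open>-1\<close> is a nonsquare.\<close>
lemma ex_switchable_3_mod_4:
  assumes "CARD('a::{field,finite}) mod 4 = 3"
  shows "\<exists>\<theta> (a::'a) b c. switchable \<theta> a b c"
proof -
  define m where "m = CARD('a) div 2"
  have card: "CARD('a) = 2 * m + 1" and m: "odd m"
    using assms unfolding m_def by presburger+
  \<comment> \<open>The quadratic character with values in the field; it is odd because
    \<open>m\<close> is.\<close>
  define \<chi> :: "'a \<Rightarrow> 'a" where "\<chi> x = x ^ m" for x
  have mult: "\<chi> (x * y) = \<chi> x * \<chi> y" "\<chi> (x / y) = \<chi> x / \<chi> y" "\<chi> (- x) = - \<chi> x" "\<chi> 1 = 1"
    "\<chi> x = 0 \<longleftrightarrow> x = 0" for x y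
    using m by (auto simp: \<chi>_def power_mult_distrib power_divide odd_pos)
  have \<chi>: "\<chi> x = 1 \<or> \<chi> x = - 1" if "x \<noteq> 0" for x
  proof -
    have "(\<chi> x)\<^sup>2 = 1"
      using power_CARD_minus_one[OF that] card by (simp add: \<chi>_def power_mult[symmetric] mult.commute)
    thus ?thesis by (simp add: power2_eq_1_iff)
  qed
  have p1: "CHAR('a) \<ge> 2" by (rule prime_ge_2_nat[OF prime_CHAR])
  have "CHAR('a) dvd CARD('a)" by (rule CHAR_dvd_CARD)
  hence "CHAR('a) \<noteq> 2" using card by auto
  with p1 have p2: "CHAR('a) > 2" by simp
  have two: "(- 1 :: 'a) \<noteq> 1"
  proof
    assume "(- 1 :: 'a) = 1"
    hence "of_nat 2 = (0 :: 'a)" by (metis of_nat_numeral one_add_one add.right_inverse)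
    thus False using p2 by (auto simp only: of_nat_eq_0_iff_char_dvd dest!: dvd_imp_le)
  qed
  have p3: "(of_nat (Suc (CHAR('a) - 2)) :: 'a) = - 1"
  proof -
    have "CHAR('a) = Suc (CHAR('a) - 2) + 1" using p2 by simp
    hence "of_nat (Suc (CHAR('a) - 2)) + 1 = (0 :: 'a)" by (metis of_nat_CHAR of_nat_add of_nat_1)
    thus ?thesis by (simp only: eq_neg_iff_add_eq_0)
  qed
  \<comment> \<open>\<open>t\<close> will be the first nonsquare among 1, 2, 3, ..., found at the
    latest at \<open>CHAR('a) - 1\<close>, whose image is \<open>- 1\<close>. Then
    \<open>t - 1\<close> is a nonzero square, so \<open>\<chi> (1 - t) = - 1\<close>.\<close>
  have ex: "\<exists>i. \<chi> (of_nat (Suc i)) \<noteq> 1"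
    using p3 two mult by metis
  define i where "i = (LEAST i. \<chi> (of_nat (Suc i)) \<noteq> 1)"
  have i1: "\<chi> (of_nat (Suc i)) \<noteq> 1" unfolding i_def by (rule LeastI_ex[OF ex])
  have i2: "\<chi> (of_nat i) = 1"
  proof (cases i)
    case 0 thus ?thesis using i1 by (simp add: mult)
  next
    case (Suc k) thus ?thesis using not_less_Least[of k "\<lambda>i. \<chi> (of_nat (Suc i)) \<noteq> 1"] i_def by simp
  qed
  define t :: 'a where "t = of_nat (Suc i)"
  have "i \<le> CHAR('a) - 2"
    unfolding i_def using p3 two mult by (intro Least_le) metis
  hence "t \<noteq> 0"
    unfolding t_def of_nat_eq_0_iff_char_dvd using p2 by (auto dest!: dvd_imp_le)
  moreover from this have \<chi>t: "\<chi> t = - 1" using i1 \<chi> by (auto simp: t_def)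
  moreover have "\<chi> (1 - t) = - 1"
    using i2 mult(3)[of "of_nat i"] by (simp add: t_def)
  ultimately have t: "t \<noteq> 0" "t \<noteq> 1" "\<chi> t = - 1" "\<chi> (1 - t) = - 1"
    using mult two by auto
  define \<theta> where "\<theta> x = (if \<chi> x = 1 then (1 - t) * x else x / t)" for x
  have \<theta>: "\<theta> x - x = (if \<chi> x = 1 then - t * x else x / (t / (1 - t)))" for x
    using t by (simp add: \<theta>_def field_simps)
  \<comment> \<open>For a square \<open>x\<close> the character of \<open>u * x\<close> is
    \<open>\<chi> u\<close>; for any other \<open>y\<close> that of \<open>y / v\<close> differs
    from \<open>\<chi> v\<close>. So the two branches have disjoint images.\<close>
  have A: "(if \<chi> x = 1 then u * x else x / v) = (if \<chi> y = 1 then u * y else y / v) \<longleftrightarrow> x = y"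
    if "u \<noteq> 0" "v \<noteq> 0" "\<chi> u = \<chi> v" for u v x y
  proof -
    have *: "u * x \<noteq> y / v" if "\<chi> x = 1" "\<chi> y \<noteq> 1" for x y
    proof
      assume "u * x = y / v"
      hence "\<chi> u * \<chi> x = \<chi> y / \<chi> v" by (metis mult(1,2))
      moreover have "\<chi> u \<noteq> 0" "(\<chi> u)\<^sup>2 = 1" using \<chi>[of u] \<open>u \<noteq> 0\<close> by auto
      ultimately show False
        using that \<open>\<chi> u = \<chi> v\<close> by (simp add: field_simps power2_eq_square)
    qed
    show ?thesis using that *[of x y] *[of y x] by auto
  qed
  have "orthomorphism \<theta>"
  proof (rule orthomorphismI)
    show "x = y" if "\<theta> x = \<theta> y" for x y
      using that A[of "1 - t" t x y] t by (simp add: \<theta>_def)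
    show "x = y" if "\<theta> x - x = \<theta> y - y" for x y
      using that A[of "- t" "t / (1 - t)" x y] t unfolding \<theta> by (simp add: mult)
  qed
  moreover have "\<theta> 0 = 0" "\<theta> 1 = 1 - t" "\<theta> t = 1"
    using t two mult by (auto simp: \<theta>_def)
  ultimately have "switchable \<theta> 0 1 t" using t by (simp add: switchable_def)
  thus ?thesis by blast
qed

section \<open>Starters from Skolem sequences\<close>

text \<open>A starter is a partition of all elements but \<open>\<psi> 0\<close> into pairs, one pair
  \<open>{\<psi> d, \<psi> (- d)}\<close> for each difference \<open>\<plusminus>d\<close>. Both \<open>\<psi>\<close> and \<open>d \<mapsto> \<psi> d + d = \<psi> (- d)\<close> are then bijective,
  so \<open>- \<psi>\<close> is an orthomorphism. It is switchable as soon as \<open>\<psi> 0, \<psi> \<delta>, \<psi> (- \<delta>)\<close> is an arithmetic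
  progression.\<close>
lemma ex_switchable_starter:
  fixes \<psi> :: "int \<Rightarrow> int" and l m \<delta> :: int
  assumes char: "CHAR('a::{field,finite}) = CARD('a)" and card: "int CARD('a) = 2 * m + 1"
    and inj: "inj_on \<psi> {- m..m}" and range: "\<psi> ` {- m..m} \<subseteq> {l..l + 2 * m}"
    and pair: "\<And>d. d \<in> {- m..m} \<Longrightarrow> \<psi> (- d) = \<psi> d + d"
    and \<delta>: "\<delta> \<in> {- m..m}" "\<delta> \<noteq> 0" "\<psi> \<delta> = \<psi> 0 + \<delta>"
  shows "\<exists>\<theta> (a::'a) b c. switchable \<theta> a b c"
proof -
  define I where "I = {- m..m}"
  have "I = {- m..< - m + int CARD('a)}" unfolding I_def card by auto
  hence bij: "bij_betw of_int I (UNIV :: 'a set)"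
    using bij_betw_of_int_interval[OF char, of "- m"] by simp
  define \<iota> where "\<iota> = the_inv_into I (of_int :: int \<Rightarrow> 'a)"
  have \<iota>: "\<iota> v \<in> I" "of_int (\<iota> v) = v" for v
    using bij unfolding \<iota>_def bij_betw_def
    by (auto intro: the_inv_into_into f_the_inv_into_f)
  have \<iota>': "\<iota> (of_int d) = d" if "d \<in> I" for d
    using bij that unfolding \<iota>_def bij_betw_def by (auto intro: the_inv_into_f_f)
  have \<psi>: "of_int (\<psi> d) = (of_int (\<psi> e) :: 'a) \<longleftrightarrow> d = e" if "d \<in> I" "e \<in> I" for d e
  proof -
    have "\<psi> d \<in> {l..<l + int CARD('a)}" "\<psi> e \<in> {l..<l + int CARD('a)}"
      using that range unfolding I_def card by fastforce+
    hence "of_int (\<psi> d) = (of_int (\<psi> e) :: 'a) \<longleftrightarrow> \<psi> d = \<psi> e"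
      using bij_betw_of_int_interval[OF char, of l] by (auto simp: bij_betw_def inj_on_def)
    thus ?thesis using inj that by (auto simp: I_def inj_on_def)
  qed
  define \<theta> :: "'a \<Rightarrow> 'a" where "\<theta> v = - of_int (\<psi> (\<iota> v))" for v
  have minus: "- d \<in> I" if "d \<in> I" for d using that by (auto simp: I_def)
  have \<theta>: "\<theta> v - v = - of_int (\<psi> (- \<iota> v))" for v
    using \<iota>[of v] pair[of "\<iota> v"] by (simp add: \<theta>_def I_def)
  have "orthomorphism \<theta>"
  proof (rule orthomorphismI)
    show "v = w" if "\<theta> v = \<theta> w" for v w
      using that \<psi>[OF \<iota>(1) \<iota>(1), of v w] \<iota> unfolding \<theta>_def by (metis neg_equal_iff_equal)
    show "v = w" if "\<theta> v - v = \<theta> w - w" for v w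
      using that \<psi>[OF minus minus, OF \<iota>(1) \<iota>(1), of v w] \<iota> unfolding \<theta> by (metis neg_equal_iff_equal)
  qed
  moreover have "0 \<in> I" "\<delta> \<in> I" "- \<delta> \<in> I" using \<delta> by (auto simp: I_def)
  moreover from this have "(of_int d :: 'a) \<noteq> of_int e" if "{d, e} \<subseteq> {0, \<delta>, - \<delta>}" "d \<noteq> e" for d e
    using that \<iota>' by (metis empty_subsetI insert_subset insertE subset_iff singletonD)
  from this[of 0 \<delta>] this[of 0 "- \<delta>"] this[of \<delta> "- \<delta>"] \<delta>
  have "(of_int \<delta> :: 'a) \<noteq> 0" "(of_int \<delta> :: 'a) \<noteq> - of_int \<delta>" by auto
  moreover have "\<psi> (- \<delta>) = \<psi> 0 + \<delta> + \<delta>" using pair[OF \<delta>(1)] \<delta>(3) by simp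
  ultimately have "switchable \<theta> 0 (of_int (- \<delta>)) (of_int \<delta>)"
    using \<iota>'[of 0] \<iota>'[of \<delta>] \<iota>'[of "- \<delta>"] \<delta> by (auto simp: switchable_def \<theta>_def)
  thus ?thesis by blast
qed

text \<open>Skolem sequences treat even and odd differences by different formulas:
  \<open>\<epsilon> e\<close> belongs to the difference \<open>2 * e\<close>,
  \<open>\<omega> e\<close> to \<open>2 * e + 1\<close>. Negating the difference turns the index
  into \<open>- e\<close> or \<open>- 1 - e\<close>.\<close>

lemma ex_switchable_starter_parity:
  fixes \<epsilon> \<omega> :: "int \<Rightarrow> int" and l m \<delta> :: int
  assumes char: "CHAR('a::{field,finite}) = CARD('a)" and card: "int CARD('a) = 2 * m + 1"
    and range: "\<And>e. 2 * e \<in> {- m..m} \<Longrightarrow> \<epsilon> e \<in> {l..l + 2 * m}"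
      "\<And>e. 2 * e + 1 \<in> {- m..m} \<Longrightarrow> \<omega> e \<in> {l..l + 2 * m}"
    and inj: "\<And>e e'. \<epsilon> e = \<epsilon> e' \<Longrightarrow> 2 * e \<in> {- m..m} \<Longrightarrow> 2 * e' \<in> {- m..m} \<Longrightarrow> e = e'"
      "\<And>e e'. \<omega> e = \<omega> e' \<Longrightarrow> 2 * e + 1 \<in> {- m..m} \<Longrightarrow> 2 * e' + 1 \<in> {- m..m} \<Longrightarrow> e = e'"
      "\<And>e e'. 2 * e \<in> {- m..m} \<Longrightarrow> 2 * e' + 1 \<in> {- m..m} \<Longrightarrow> \<epsilon> e \<noteq> \<omega> e'"
    and pair: "\<And>e. 2 * e \<in> {- m..m} \<Longrightarrow> \<epsilon> (- e) = \<epsilon> e + 2 * e"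
      "\<And>e. 2 * e + 1 \<in> {- m..m} \<Longrightarrow> \<omega> (- 1 - e) = \<omega> e + (2 * e + 1)"
    and \<delta>: "\<delta> \<in> {- m..m}" "\<delta> \<noteq> 0"
      "(if even \<delta> then \<epsilon> (\<delta> div 2) else \<omega> (\<delta> div 2)) = \<epsilon> 0 + \<delta>"
  shows "\<exists>\<theta> (a::'a) b c. switchable \<theta> a b c"
proof -
  define \<psi> where "\<psi> d = (if even d then \<epsilon> (d div 2) else \<omega> (d div 2))" for d
  have even: "\<psi> (2 * e) = \<epsilon> e" and odd: "\<psi> (2 * e + 1) = \<omega> e" for e
    by (simp_all add: \<psi>_def)
  have cases: "P d" if "\<And>e. P (2 * e)" "\<And>e. P (2 * e + 1)" for P and d :: int
    using that by (metis evenE oddE)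
  show ?thesis
  proof (rule ex_switchable_starter[OF char card, where l = l and \<psi> = \<psi> and \<delta> = \<delta>])
    show "inj_on \<psi> {- m..m}"
    proof (rule inj_onI)
      fix d d' assume "d \<in> {- m..m}" "d' \<in> {- m..m}" "\<psi> d = \<psi> d'"
      thus "d = d'"
        using inj by (induction d rule: cases; induction d' rule: cases) (metis even odd)+
    qed
    show "\<psi> ` {- m..m} \<subseteq> {l..l + 2 * m}"
    proof (rule image_subsetI)
      show "\<psi> d \<in> {l..l + 2 * m}" if "d \<in> {- m..m}" for d
        using that by (induction d rule: cases) (simp_all only: even odd range)
    qed
    show "\<psi> (- d) = \<psi> d + d" if "d \<in> {- m..m}" for d
      using that
    proof (induction d rule: cases)
      case (1 e)
      thus ?case using pair(1) even[of "- e"] by (simp add: even)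
    next
      case (2 e)
      have "- (2 * e + 1) = 2 * (- 1 - e) + 1" by simp
      thus ?case by (simp only: odd pair(2)[OF 2])
    qed
  qed (use \<delta> even[of 0] in \<open>auto simp: \<psi>_def\<close>)
qed

text \<open>The pairs are the positions of equal entries in Skolem's sequence of order \<open>4 s\<close>,
  and the fixed point is \<open>0\<close>. It continues to the progression \<open>0, 4 s, 8 s\<close>, which ends with a pair.\<close>
lemma ex_switchable_prime_1_mod_8:
  fixes s :: int
  assumes char: "CHAR('a::{field,finite}) = CARD('a)" and card: "int CARD('a) = 8 * s + 1" and s: "s \<ge> 2"
  shows "\<exists>\<theta> (a::'a) b c. switchable \<theta> a b c"
proof -
  \<comment> \<open>The nested pairs \<open>6 * s - e\<close>, \<open>6 * s + e\<close> fill
    \<open>4 * s..8 * s\<close> except the centre, which goes to the odd difference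
    \<open>4 * s - 1\<close>.\<close>
  define \<epsilon> where "\<epsilon> e = (if e = 0 then 0 else 6 * s - e)" for e
  define \<omega> where "\<omega> e = (if e \<le> - 2 * s then 6 * s else if e \<le> - s - 1 then 2 * s - 1 - e
    else if e \<le> - s then 4 * s - 1 else if e \<le> - 2 then 2 * s - e
    else if e \<le> - 1 then s + 1 else if e \<le> 0 then s
    else if e \<le> s - 2 then 2 * s - e else if e \<le> s - 1 then 2 * s
    else if e \<le> 2 * s - 2 then 2 * s - 1 - e else 2 * s + 1)" for e
  \<comment> \<open>The left inverse of \<open>\<omega>\<close> replaces a comparison of all pairs
    of branches by one case split.\<close>
  define \<omega>' where "\<omega>' x = (if x \<le> s - 1 then 2 * s - 1 - x else if x \<le> s then 0
    else if x \<le> s + 1 then - 1 else if x \<le> 2 * s - 1 then 2 * s - x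
    else if x \<le> 2 * s then s - 1 else if x \<le> 2 * s + 1 then 2 * s - 1
    else if x \<le> 3 * s - 1 then 2 * s - x else if x \<le> 4 * s - 2 then 2 * s - 1 - x
    else if x \<le> 4 * s - 1 then - s else - 2 * s)" for x
  show ?thesis
  proof (rule ex_switchable_starter_parity[OF char, where m = "4 * s" and \<epsilon> = \<epsilon> and \<omega> = \<omega> and l = 0 and \<delta> = "4 * s"])
    let ?I = "{- (4 * s)..4 * s}"
    have I: "2 * e \<in> ?I \<longleftrightarrow> - 2 * s \<le> e \<and> e \<le> 2 * s"
      "2 * e + 1 \<in> ?I \<longleftrightarrow> - 2 * s \<le> e \<and> e < 2 * s" for e
      by auto
    show "\<epsilon> e \<in> {0..0 + 2 * (4 * s)}" if "2 * e \<in> ?I" for e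
      using that s by (auto simp: \<epsilon>_def)
    show "\<epsilon> (- e) = \<epsilon> e + 2 * e" for e by (simp add: \<epsilon>_def)
    show "e = e'" if "\<epsilon> e = \<epsilon> e'" "2 * e \<in> ?I" "2 * e' \<in> ?I" for e e'
      using that s unfolding \<epsilon>_def by (auto split: if_splits)
    show "\<omega> e \<in> {0..0 + 2 * (4 * s)}" if "2 * e + 1 \<in> ?I" for e
      using that s by (auto simp: \<omega>_def)
    show "\<omega> (- 1 - e) = \<omega> e + (2 * e + 1)" if "2 * e + 1 \<in> ?I" for e
      using that s unfolding I by (auto simp: \<omega>_def)
    have "\<omega>' (\<omega> e) = e" if "2 * e + 1 \<in> ?I" for e
      using that s unfolding I by (auto simp: \<omega>_def \<omega>'_def)
    thus "e = e'" if "\<omega> e = \<omega> e'" "2 * e + 1 \<in> ?I" "2 * e' + 1 \<in> ?I" for e e'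
      using that by metis
    have "\<omega> e \<in> {1..4 * s - 1} \<union> {6 * s}" if "2 * e + 1 \<in> ?I" for e
      using that s unfolding I by (auto simp: \<omega>_def)
    moreover have "\<epsilon> e \<notin> {1..4 * s - 1} \<union> {6 * s}" if "2 * e \<in> ?I" for e
      using that s unfolding I by (auto simp: \<epsilon>_def)
    ultimately show "\<epsilon> e \<noteq> \<omega> e'" if "2 * e \<in> ?I" "2 * e' + 1 \<in> ?I" for e e'
      using that by metis
  qed (use s card in \<open>simp_all add: \<epsilon>_def\<close>)
qed

text \<open>The pairs are the positions of equal entries in the hooked Skolem sequence of order
  \<open>4 s + 2\<close> with \<open>s = 3 j\<close>. Its hole \<open>8 s + 4\<close> is the fixed point, and
  \<open>24 j + 4, 20 j + 3, 16 j + 2\<close> is a progression from the hole that ends with a pair.\<close>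
lemma ex_switchable_prime_5_mod_24:
  fixes j :: int
  assumes char: "CHAR('a::{field,finite}) = CARD('a)" and card: "int CARD('a) = 24 * j + 5" and j: "j \<ge> 1"
  shows "\<exists>\<theta> (a::'a) b c. switchable \<theta> a b c"
proof -
  define s where "s = 3 * j"
  have s: "s \<ge> 3" using j by (simp add: s_def)
  \<comment> \<open>Nested pairs around \<open>2 * s + 1\<close>, except that the largest difference
    \<open>4 * s + 2\<close> pairs \<open>4 * s + 3\<close> with \<open>8 * s + 5\<close>, past the
    hole.\<close>
  define \<epsilon> where "\<epsilon> e = (if e = 0 then 8 * s + 4 else if e = 2 * s + 1 then 4 * s + 3
    else if e = - 2 * s - 1 then 8 * s + 5 else 2 * s + 1 - e)" for e
  define \<omega> where "\<omega> e = (if e \<le> - 2 * s - 1 then 6 * s + 2 else if e \<le> - s - 2 then 6 * s + 3 - e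
    else if e \<le> - s - 1 then 6 * s + 3 else if e \<le> - 2 then 6 * s + 2 - e
    else if e \<le> - 1 then 7 * s + 4 else if e \<le> 0 then 7 * s + 3
    else if e \<le> s - 1 then 6 * s + 2 - e else if e \<le> s then 4 * s + 2
    else if e \<le> 2 * s - 1 then 6 * s + 3 - e else 2 * s + 1)" for e
  define \<omega>' where "\<omega>' x = (if x \<le> 2 * s + 1 then 2 * s else if x \<le> 4 * s + 2 then s
    else if x \<le> 5 * s + 2 then 6 * s + 3 - x else if x \<le> 6 * s + 1 then 6 * s + 2 - x
    else if x \<le> 6 * s + 2 then - 2 * s - 1 else if x \<le> 6 * s + 3 then - s - 1
    else if x \<le> 7 * s + 2 then 6 * s + 2 - x else if x \<le> 7 * s + 3 then 0
    else if x \<le> 7 * s + 4 then - 1 else 6 * s + 3 - x)" for x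
  show ?thesis
  proof (rule ex_switchable_starter_parity[OF char, where m = "4 * s + 2" and \<epsilon> = \<epsilon> and \<omega> = \<omega> and l = 1
        and \<delta> = "- (4 * j + 1)"])
    let ?I = "{- (4 * s + 2)..4 * s + 2}"
    have I: "2 * e \<in> ?I \<longleftrightarrow> - 2 * s - 1 \<le> e \<and> e \<le> 2 * s + 1"
      "2 * e + 1 \<in> ?I \<longleftrightarrow> - 2 * s - 1 \<le> e \<and> e \<le> 2 * s" for e
      by auto
    show "\<epsilon> e \<in> {1..1 + 2 * (4 * s + 2)}" if "2 * e \<in> ?I" for e
      using that s by (auto simp: \<epsilon>_def)
    show "\<epsilon> (- e) = \<epsilon> e + 2 * e" if "2 * e \<in> ?I" for e
      using that s unfolding I by (auto simp: \<epsilon>_def)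
    show "e = e'" if "\<epsilon> e = \<epsilon> e'" "2 * e \<in> ?I" "2 * e' \<in> ?I" for e e'
      using that s unfolding \<epsilon>_def I by (auto split: if_splits)
    show "\<omega> e \<in> {1..1 + 2 * (4 * s + 2)}" if "2 * e + 1 \<in> ?I" for e
      using that s by (auto simp: \<omega>_def)
    show "\<omega> (- 1 - e) = \<omega> e + (2 * e + 1)" if "2 * e + 1 \<in> ?I" for e
      using that s unfolding I by (auto simp: \<omega>_def)
    have "\<omega>' (\<omega> e) = e" if "2 * e + 1 \<in> ?I" for e
      using that s unfolding I by (auto simp: \<omega>_def \<omega>'_def)
    thus "e = e'" if "\<omega> e = \<omega> e'" "2 * e + 1 \<in> ?I" "2 * e' + 1 \<in> ?I" for e e'
      using that by metis
    have "\<omega> e \<in> {2 * s + 1, 4 * s + 2} \<union> {4 * s + 4..8 * s + 3}" if "2 * e + 1 \<in> ?I" for e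
      using that s unfolding I by (auto simp: \<omega>_def)
    moreover have "\<epsilon> e \<notin> {2 * s + 1, 4 * s + 2} \<union> {4 * s + 4..8 * s + 3}" if "2 * e \<in> ?I" for e
      using that s unfolding I by (auto simp: \<epsilon>_def)
    ultimately show "\<epsilon> e \<noteq> \<omega> e'" if "2 * e \<in> ?I" "2 * e' + 1 \<in> ?I" for e e'
      using that by metis
    \<comment> \<open>In the branch \<open>\<omega> e = 6 * s + 2 - e\<close>, the equation
      \<open>\<omega> e = 8 * s + 4 + (2 * e + 1)\<close> forces \<open>3 * e = - 2 * s - 3\<close>;
      hence the choice \<open>s = 3 * j\<close>.\<close>
    have "- (4 * j + 1) div 2 = - 2 * j - 1" by presburger
    moreover have "\<omega> (- 2 * j - 1) = 20 * j + 3" using j by (simp add: \<omega>_def s_def)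
    ultimately show "(if even (- (4 * j + 1)) then \<epsilon> (- (4 * j + 1) div 2) else \<omega> (- (4 * j + 1) div 2))
        = \<epsilon> 0 + - (4 * j + 1)"
      by (simp add: \<epsilon>_def s_def)
  qed (use j card in \<open>simp_all add: s_def\<close>)
qed

section \<open>Extensions of the prime field\<close>

text \<open>For nonzero \<open>x\<close> the inverse is the power \<open>x ^ (CARD('a) - 2)\<close>.
  So the multiples of 1 form a subfield.\<close>

lemma inverse_in_range_of_int:
  assumes "x \<in> range (of_int :: int \<Rightarrow> 'a::{field,finite})"
  shows "inverse x \<in> range (of_int :: int \<Rightarrow> 'a)"
proof (cases "x = 0")
  case True
  thus ?thesis using assms by simp
next
  case False
  obtain i where i: "x = of_int i" using assms by blast
  have "card {0, 1::'a} \<le> CARD('a)" by (rule card_mono) auto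
  hence "CARD('a) - 1 = Suc (CARD('a) - 2)" by simp
  hence "x * x ^ (CARD('a) - 2) = 1"
    using power_CARD_minus_one[OF False] by simp
  hence "inverse x = of_int (i ^ (CARD('a) - 2))"
    using i by (simp add: inverse_unique)
  thus ?thesis by blast
qed

text \<open>Let \<open>P\<close> be the prime field, \<open>u \<notin> P\<close> and \<open>H = P + P u\<close>. On \<open>H\<close> the orthomorphism is the
  linear map \<open>L\<close> with \<open>L 1 = u\<close> and \<open>L u = u - 1\<close>; it is continued to all cosets of \<open>H\<close> by
  doubling a set \<open>r\<close> of coset representatives.\<close>
lemma ex_switchable_extension:
  fixes u :: "'a::{field,finite}"
  assumes two: "(2::'a) \<noteq> 0" and u: "u \<notin> range of_int"
  shows "\<exists>\<theta> (a::'a) b c. switchable \<theta> a b c"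
proof -
  define P where "P = range (of_int :: int \<Rightarrow> 'a)"
  have of_int_P: "of_int i \<in> P" for i by (simp add: P_def)
  from this[of 0] this[of 1] this[of 2] have num_P: "0 \<in> P" "1 \<in> P" "2 \<in> P" by simp_all
  have P: "x + y \<in> P" "x - y \<in> P" "x * y \<in> P" "x / y \<in> P" if xy: "x \<in> P" "y \<in> P" for x y
  proof -
    obtain i j where ij: "x = of_int i" "y = of_int j" using xy unfolding P_def by blast
    show "x + y \<in> P" "x - y \<in> P" "x * y \<in> P"
      unfolding ij of_int_add[symmetric] of_int_diff[symmetric] of_int_mult[symmetric]
      by (rule of_int_P)+
    obtain k where "inverse y = of_int k" using inverse_in_range_of_int xy(2) by (auto simp: P_def)
    thus "x / y \<in> P"
      unfolding divide_inverse ij by (metis of_int_P of_int_mult)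
  qed
  have unique: "x = x' \<and> y = y'" if "x + y * u = x' + y' * u" "{x, y, x', y'} \<subseteq> P" for x y x' y'
  proof (cases "y = y'")
    case False
    hence "u = (x - x') / (y' - y)" using that(1) by (simp add: field_simps)
    thus ?thesis using u that(2) P by (auto simp: P_def[symmetric])
  qed (use that in auto)
  define H where "H = {x + y * u | x y. x \<in> P \<and> y \<in> P}"
  have HI: "x + y * u \<in> H" if "x \<in> P" "y \<in> P" for x y using that by (auto simp: H_def)
  have H_diff: "v - w \<in> H" if vw: "v \<in> H" "w \<in> H" for v w
  proof -
    obtain x y x' y' where "v = x + y * u" "w = x' + y' * u" "x \<in> P" "y \<in> P" "x' \<in> P" "y' \<in> P"
      using vw by (auto simp: H_def)
    hence "v - w = (x - x') + (y - y') * u" "x - x' \<in> P" "y - y' \<in> P" using P by (auto simp: algebra_simps)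
    thus ?thesis using HI by metis
  qed
  have H_0: "0 \<in> H" using HI[of 0 0] num_P by simp
  have H_add: "v + w \<in> H" if "v \<in> H" "w \<in> H" for v w
    using H_diff[OF that(1) H_diff[OF H_0 that(2)]] by simp
  \<comment> \<open>Halving within \<open>H\<close> makes doubling injective on cosets; odd
    characteristic enters here.\<close>
  have H_half: "v \<in> H" if v: "2 * v \<in> H" for v
  proof -
    obtain x y where xy: "2 * v = x + y * u" "x \<in> P" "y \<in> P" using v by (auto simp: H_def)
    hence "v = x / 2 + y / 2 * u" using two by (simp add: field_simps)
    thus ?thesis using HI[of "x / 2" "y / 2"] xy P num_P by simp
  qed
  define r where "r v = (if v \<in> H then 0 else SOME w. v - w \<in> H)" for v
  have r: "v - r v \<in> H" for v
    using someI[of "\<lambda>w. v - w \<in> H" v] H_0 by (simp add: r_def)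
  have r_eq: "r v = r w" if "v - w \<in> H" for v w
  proof -
    have "v - z \<in> H \<longleftrightarrow> w - z \<in> H" for z
      using H_add[OF that, of "w - z"] H_diff[OF _ that, of "v - z"] by auto
    from this this[of 0] show ?thesis by (simp add: r_def)
  qed
  have "\<forall>v. \<exists>x y. x \<in> P \<and> y \<in> P \<and> v = r v + (x + y * u)"
  proof
    fix v
    obtain x y where "v - r v = x + y * u" "x \<in> P" "y \<in> P" using r[of v] by (auto simp: H_def)
    thus "\<exists>x y. x \<in> P \<and> y \<in> P \<and> v = r v + (x + y * u)" by (metis add.commute diff_add_cancel)
  qed
  then obtain X Y where XY: "\<And>v. X v \<in> P" "\<And>v. Y v \<in> P" "\<And>v. v = r v + (X v + Y v * u)"
    by metis
  \<comment> \<open>\<open>L\<close> acts on the part in \<open>H\<close>, while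
    \<open>\<theta> v - v\<close> keeps \<open>r v\<close> and applies \<open>L - 1\<close>. Both
    \<open>L\<close> and \<open>L - 1\<close> have determinant 1.\<close>
  define \<theta> where "\<theta> v = 2 * r v + ((- Y v) + (X v + Y v) * u)" for v
  have \<theta>: "\<theta> v - v = r v + ((- X v - Y v) + X v * u)" for v
    by (subst (3) XY(3)) (simp add: \<theta>_def algebra_simps)
  have minus_P: "- x \<in> P" if "x \<in> P" for x using P(2)[OF num_P(1) that] by simp
  have r_idem: "r v = r w" if "r v - r w \<in> H" for v w
  proof (rule r_eq)
    have "v - w = (v - r v) - (w - r w) + (r v - r w)" by simp
    also have "\<dots> \<in> H" by (intro H_add H_diff r that)
    finally show "v - w \<in> H" .
  qed
  have "orthomorphism \<theta>"
  proof (rule orthomorphismI)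
    show "v = w" if eq: "\<theta> v = \<theta> w" for v w
    proof -
      have "2 * (r v - r w) = ((- Y w) + (X w + Y w) * u) - ((- Y v) + (X v + Y v) * u)"
        using eq by (simp add: \<theta>_def algebra_simps)
      also have "\<dots> \<in> H" by (intro H_diff HI minus_P P XY)
      finally have rr: "r v = r w" by (rule r_idem[OF H_half])
      hence "- Y v = - Y w \<and> X v + Y v = X w + Y w"
        using eq by (intro unique) (auto simp: \<theta>_def intro: minus_P P XY)
      hence "X v = X w \<and> Y v = Y w" by auto
      thus ?thesis using rr by (subst (1 2) XY(3)) simp
    qed
    show "v = w" if eq: "\<theta> v - v = \<theta> w - w" for v w
    proof -
      have "r v - r w = ((- X w - Y w) + X w * u) - ((- X v - Y v) + X v * u)"
        using eq unfolding \<theta> by (simp add: algebra_simps)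
      also have "\<dots> \<in> H" by (intro H_diff HI minus_P P XY)
      finally have rr: "r v = r w" by (rule r_idem)
      hence "- X v - Y v = - X w - Y w \<and> X v = X w"
        using eq unfolding \<theta> by (intro unique) (auto intro: minus_P P XY)
      hence "X v = X w \<and> Y v = Y w" by auto
      thus ?thesis using rr by (subst (1 2) XY(3)) simp
    qed
  qed
  moreover have \<theta>_H: "\<theta> (x + y * u) = - y + (x + y) * u" if xy: "x \<in> P" "y \<in> P" for x y
  proof -
    have r0: "r (x + y * u) = 0" using HI[OF xy] by (simp add: r_def)
    hence "x = X (x + y * u) \<and> y = Y (x + y * u)"
      using xy XY(3)[of "x + y * u"] by (intro unique) (auto intro: XY)
    thus ?thesis using r0 by (simp add: \<theta>_def)
  qed
  have "u \<noteq> 0" "u \<noteq> 1" using u num_P by (auto simp: P_def)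
  ultimately have "switchable \<theta> 0 u 1"
    using \<theta>_H[of 0 0] \<theta>_H[of 1 0] \<theta>_H[of 0 1] num_P by (simp add: switchable_def)
  thus ?thesis by blast
qed

text \<open>View the field as a vector space over \<open>\<bbbF>\<^sub>2\<close> of dimension \<open>k\<close> and let \<open>L\<close> act on a basis in
  blocks of size \<open>2\<close> with characteristic polynomial \<open>x\<^sup>2 + x + 1\<close>, and for odd \<open>k\<close> one block of
  size \<open>3\<close> with characteristic polynomial \<open>x\<^sup>3 + x + 1\<close>. As \<open>(x\<^sup>2 + x + 1) (x\<^sup>3 + x + 1) = x\<^sup>5 + x\<^sup>4 + 1\<close>,
  the map \<open>L\<^sup>4 (L + 1)\<close> is the identity.\<close>
lemma ex_switchable_char_2:
  assumes two: "(2::'a::{field,finite}) = 0" and card: "CARD('a) \<noteq> 2" "CARD('a) \<noteq> 8"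
  shows "\<exists>\<theta> (a::'a) b c. switchable \<theta> a b c"
proof -
  have self: "x + x = 0" for x :: 'a
    using two by (metis mult_2 mult_zero_left)
  have self': "x + (x + y) = y" for x y :: 'a
    using self by (metis add.assoc add_0)
  define scale where "scale c x = (if c = 1 then x else 0)" for c :: bit and x :: 'a
  interpret V: vector_space scale
  proof
    fix c d :: bit and x y :: 'a
    show "scale c (x + y) = scale c x + scale c y" "scale 1 x = x"
      by (simp_all add: scale_def)
    show "scale (c + d) x = scale c x + scale d x"
      by (cases c; cases d) (simp_all add: scale_def self)
    show "scale c (scale d x) = scale (c * d) x"
      by (simp add: scale_def)
  qed
  interpret VV: vector_space_pair scale scale
    by (rule vector_space_pair.intro[OF V.vector_space_axioms V.vector_space_axioms])
  obtain B where "V.independent B" "UNIV \<subseteq> V.span B"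
    by (rule V.basis_exists[of UNIV])
  hence B: "V.independent B" "V.span B = UNIV" by auto
  define k where "k = card B"
  have sum_scale: "(\<Sum>v\<in>B. scale (f v) v) = \<Sum>{v\<in>B. f v = 1}" for f
    by (simp add: scale_def sum.inter_filter)
  \<comment> \<open>Subset sums of the basis enumerate the field, so its order is
    \<open>2 ^ k\<close>.\<close>
  have "bij_betw Sum (Pow B) UNIV"
    unfolding bij_betw_def
  proof
    show "Sum ` Pow B = UNIV"
    proof (intro equalityI subsetI)
      fix x :: 'a
      obtain f where "x = (\<Sum>v\<in>B. scale (f v) v)"
        using B(2) V.span_finite[of B] by auto
      thus "x \<in> Sum ` Pow B" unfolding sum_scale by auto
    qed auto
    show "inj_on Sum (Pow B)"
    proof (rule inj_onI)
      fix S T assume ST: "S \<in> Pow B" "T \<in> Pow B" "\<Sum>S = \<Sum>T"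
      define f g :: "'a \<Rightarrow> bit" where "f v = of_bool (v \<in> S)" and "g v = of_bool (v \<in> T)" for v
      have "{v \<in> B. f v = 1} = S" "{v \<in> B. g v = 1} = T"
        using ST by (auto simp: f_def g_def)
      moreover have "(\<Sum>v\<in>B. scale (f v + g v) v) = (\<Sum>v\<in>B. scale (f v) v) + (\<Sum>v\<in>B. scale (g v) v)"
        by (simp only: V.scale_left_distrib sum.distrib)
      ultimately have "(\<Sum>v\<in>B. scale (f v + g v) v) = 0"
        by (simp only: sum_scale ST(3) self)
      hence "f v + g v = 0" if "v \<in> B" for v
        using V.independentD[OF B(1) _ subset_refl, of "\<lambda>v. f v + g v"] that finite by blast
      hence "v \<in> S \<longleftrightarrow> v \<in> T" if "v \<in> B" for v
        using that by (cases "v \<in> S"; cases "v \<in> T") (force simp: f_def g_def)+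
      thus "S = T" using ST by auto
    qed
  qed
  hence "CARD('a) = 2 ^ k"
    by (metis bij_betw_same_card card_Pow finite k_def)
  moreover have "card {0, 1::'a} \<le> CARD('a)" by (rule card_mono) auto
  ultimately have k: "k \<noteq> 0" "k \<noteq> 1" "k \<noteq> 3" using card by (auto intro: ccontr)
  obtain e where e: "bij_betw e {..<k} B"
    using ex_bij_betw_nat_finite[of B] by (auto simp: k_def atLeast0LessThan)
  \<comment> \<open>For odd \<open>k\<close> the block of size 3 is \<open>e 0, e 1, e 2\<close>.
    Blocks of size 2 start where \<open>i + k\<close> is even, so that the last one ends at
    \<open>k - 1\<close>.\<close>
  define l where "l i = (if odd k \<and> i < 2 then e (i + 1) else if odd k \<and> i = 2 then e 0 + e 1
    else if even (i + k) then e i + e (i + 1) else e (i - 1))" for i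
  define L where "L = VV.construct B (\<lambda>v. l (the_inv_into {..<k} e v))"
  have lin: "Vector_Spaces.linear scale scale L"
    unfolding L_def by (rule VV.linear_construct[OF B(1)])
  have add: "L (x + y) = L x + L y" for x y
    using lin by (rule VV.linear_add)
  have L: "L (e i) = l i" if "i < k" for i
  proof -
    have "e i \<in> B" "the_inv_into {..<k} e (e i) = i"
      using e that by (auto simp: bij_betw_def the_inv_into_f_f)
    thus ?thesis unfolding L_def using VV.construct_basis[OF B(1)] by simp
  qed
  have block2: "L (e i) = e i + e (i + 1) \<and> L (e (i + 1)) = e i"
    if "even (i + k)" "i < k" "odd k \<Longrightarrow> 3 \<le> i" for i
  proof -
    have "i + 1 < k" using that by (cases "i + 1 = k") auto
    thus ?thesis using that L[of i] L[of "i + 1"] by (auto simp: l_def)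
  qed
  have k3: "3 \<le> k" if "odd k" using that k by presburger
  have block3: "L (e 0) = e 1" "L (e 1) = e 2" "L (e 2) = e 0 + e 1" if "odd k"
    using that k3[OF that] L[of 0] L[of 1] L[of 2] by (auto simp: l_def numeral_2_eq_2)
  have basis: "L (L (L (L (L (e i))))) + L (L (L (L (e i)))) = e i" if i: "i < k" for i
  proof -
    have *: "L (L (L (L (L x)))) + L (L (L (L x))) = x"
      if "L b = b + c" "L c = b" "x = b \<or> x = c" for x b c
      using that by (auto simp: add self self' ac_simps)
    consider "odd k" "i < 3" | "even (i + k)" "odd k \<Longrightarrow> 3 \<le> i"
      | "odd (i + k)" "odd k \<Longrightarrow> 3 \<le> i" by linarith
    thus ?thesis
    proof cases
      case 1
      hence "i = 0 \<or> i = 1 \<or> i = 2" by auto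
      thus ?thesis using block3[OF 1(1)] by (auto simp: add self self' ac_simps)
    next
      case 2
      thus ?thesis using block2[OF 2(1) i 2(2)] * by blast
    next
      case 3
      hence "i \<noteq> 0" "odd k \<Longrightarrow> i \<noteq> 3" by (auto intro: Nat.gr0I)
      then obtain j where j: "i = j + 1" "odd k \<Longrightarrow> 3 \<le> j"
        using 3(2) by (metis Suc_eq_plus1 not0_implies_Suc le_Suc_eq numeral_3_eq_3 add_right_imp_eq)
      hence "L (e j) = e j + e (j + 1) \<and> L (e (j + 1)) = e j"
        using 3 i by (intro block2) auto
      thus ?thesis unfolding j(1) using * by blast
    qed
  qed
  have id: "L (L (L (L (L x)))) + L (L (L (L x))) = x" for x
  proof -
    have L0: "L 0 = 0" using lin by (rule VV.linear_0)
    have "x \<in> V.span B" using B by simp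
    thus ?thesis
    proof (induction rule: V.span_induct_alt)
      case (step c v y)
      obtain i where "v = e i" "i < k" using step(1) e by (auto simp: bij_betw_def)
      hence "L (L (L (L (L v)))) + L (L (L (L v))) = v" using basis by simp
      thus ?case using step(2) by (cases c) (simp_all add: scale_def add L0 ac_simps)
    qed (simp add: L0)
  qed
  have "orthomorphism L"
  proof (rule orthomorphismI)
    show "x = y" if "L x = L y" for x y
      using id[of x] id[of y] unfolding that by (rule trans[OF sym])
    show "x = y" if "L x - x = L y - y" for x y
    proof -
      have "L x = L (x - y) + L y" using add[of "x - y" y] by simp
      hence fixed: "L (x - y) = x - y" using that by (simp add: algebra_simps)
      \<comment> \<open>By the identity, a fixed point \<open>z\<close> of \<open>L\<close>
        satisfies \<open>z = z + z = 0\<close>.\<close>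
      have "x - y = 0" using id[of "x - y"] unfolding fixed self by (rule sym)
      thus ?thesis by simp
    qed
  qed
  \<comment> \<open>As \<open>k\<close> is not 0, 1 or 3, a block of size 2 exists. On the last one,
    \<open>b = e j\<close> and \<open>c = e (j + 1)\<close> satisfy \<open>L b = b - c\<close> and
    \<open>L c = b\<close>.\<close>
  moreover obtain j where j: "k = j + 2" "odd k \<Longrightarrow> 3 \<le> j"
  proof
    show "k = (k - 2) + 2" using k by simp
    show "3 \<le> k - 2" if "odd k" using that k by presburger
  qed
  hence "L (e j) = e j + e (j + 1) \<and> L (e (j + 1)) = e j"
    by (intro block2) auto
  moreover have "e j \<noteq> e (j + 1)" "e j \<in> B" "e (j + 1) \<in> B"
    using e j(1) inj_onD[of e "{..<k}" j "j + 1"] by (auto simp: bij_betw_def)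
  moreover from this have "e j \<noteq> 0" "e (j + 1) \<noteq> 0"
    using V.dependent_zero B(1) by metis+
  moreover have "L 0 = 0" using lin by (rule VV.linear_0)
  moreover have "- x = x" for x :: 'a using self by (simp add: minus_unique)
  ultimately have "switchable L 0 (e j) (e (j + 1))"
    by (auto simp: switchable_def diff_conv_add_uminus simp del: add_uminus_conv_diff)
  thus ?thesis by blast
qed

section \<open>The exceptional fields\<close>

lemma switchable_at_0:
  fixes a b c :: "'a::ab_group_add"
  assumes "switchable \<theta> a b c"
  obtains \<eta> and v w :: 'a where "orthomorphism \<eta>" "v \<noteq> 0" "w \<noteq> 0" "v \<noteq> w"
    "\<eta> 0 = 0" "\<eta> v = v - w" "\<eta> w = v"
  by (rule that[of "\<lambda>x. \<theta> (x + a) - \<theta> a" "b - a" "c - a"])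
     (use switchable_normalize[OF assms] in \<open>auto simp: switchable_def\<close>)

text \<open>Scaling by \<open>b\<close> reduces to the points \<open>0, 1, t\<close> with
  \<open>t\<close> in \<open>{2, 3, 4}\<close> and the values \<open>0, 1 - t, 1\<close>. In each
  case one further argument has no admissible value left.\<close>

lemma not_switchable_5:
  fixes a b c :: "'a::{field,finite}"
  assumes card: "CARD('a) = 5"
  shows "\<not> switchable \<theta> a b c"
proof
  assume "switchable \<theta> a b c"
  then obtain \<theta> and b c :: 'a where o: "orthomorphism \<theta>" and bc: "b \<noteq> 0" "c \<noteq> 0" "b \<noteq> c"
    and v: "\<theta> 0 = 0" "\<theta> b = b - c" "\<theta> c = b" by (rule switchable_at_0)
  have "CHAR('a) dvd 5" using CHAR_dvd_CARD[where 'a = 'a] card by simp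
  moreover have "prime (5::nat)" by simp
  ultimately have char: "CHAR('a) = 5" by (metis prime_CHAR primes_dvd_imp_eq)
  have eq: "of_int i = (of_int j :: 'a) \<longleftrightarrow> i mod 5 = j mod 5" for i j
    by (simp add: of_int_eq_iff_cong_CHAR char cong_def)
  have rep: "\<exists>i. of_int i = x \<and> 0 \<le> i \<and> i < 5" for x :: 'a
  proof -
    have "x \<in> of_int ` {0..<0 + int CARD('a)}"
      using bij_betw_of_int_interval[where 'a = 'a, of 0] char card by (simp add: bij_betw_def)
    thus ?thesis using card by auto
  qed
  have "\<forall>i. \<exists>j. of_int j = \<theta> (b * of_int i) / b \<and> 0 \<le> j \<and> j < 5" using rep by blast
  then obtain f where f: "\<And>i. b * of_int (f i) = \<theta> (b * of_int i)" "\<And>i. 0 \<le> f i \<and> f i < 5"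
    using bc(1) by (metis nonzero_mult_div_cancel_left times_divide_eq_right)
  obtain t where t: "of_int t = c / b" "0 \<le> t" "t < 5" using rep by blast
  have inj: "f i mod 5 = f j mod 5 \<longleftrightarrow> i mod 5 = j mod 5" for i j
  proof -
    have "f i mod 5 = f j mod 5 \<longleftrightarrow> b * of_int (f i) = b * of_int (f j)"
      using bc(1) by (simp add: eq)
    thus ?thesis using bc(1) by (simp add: f orthomorphismD[OF o] eq)
  qed
  have inj': "(f i - i) mod 5 = (f j - j) mod 5 \<longleftrightarrow> i mod 5 = j mod 5" for i j
  proof -
    have "(f i - i) mod 5 = (f j - j) mod 5 \<longleftrightarrow> b * of_int (f i - i) = b * of_int (f j - j)"
      using bc(1) by (simp add: eq del: of_int_diff)
    thus ?thesis using bc(1) by (simp add: right_diff_distrib f orthomorphismD[OF o] eq)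
  qed
  have c: "c = b * of_int t" using t bc(1) by simp
  have "b * of_int (f 0) = b * of_int 0" "b * of_int (f 1) = b * of_int (1 - t)"
    "b * of_int (f t) = b * of_int 1"
    using v c by (simp_all add: f right_diff_distrib)
  hence "f 0 mod 5 = 0" "f 1 mod 5 = (1 - t) mod 5" "f t mod 5 = 1"
    using bc(1) unfolding mult_cancel_left eq by simp_all
  hence f0: "f 0 = 0" and f1: "f 1 = (1 - t) mod 5" and ft: "f t = 1" using f(2) by simp_all
  have "b * of_int t \<noteq> b * of_int 0" "b * of_int t \<noteq> b * of_int 1" using bc c by auto
  hence "t \<noteq> 0" "t \<noteq> 1" by auto
  hence "t = 2 \<or> t = 3 \<or> t = 4" using t by auto
  moreover have val: "f i = 0 \<or> f i = 1 \<or> f i = 2 \<or> f i = 3 \<or> f i = 4" for i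
    using f(2)[of i] by auto
  ultimately consider "t = 2" | "t = 3" | "t = 4" by blast
  thus False
  proof cases
    case 1
    thus False
      using val[of 3] inj[of 0 3] inj[of 1 3] inj[of 2 3] inj'[of 0 3] inj'[of 2 3] f0 f1 ft by auto
  next
    case 2
    thus False
      using val[of 2] inj[of 0 2] inj[of 1 2] inj[of 3 2] inj'[of 0 2] inj'[of 1 2] f0 f1 ft by auto
  next
    case 3
    thus False
      using val[of 2] inj[of 0 2] inj[of 1 2] inj[of 4 2] inj'[of 1 2] inj'[of 4 2] f0 f1 ft by auto
  qed
qed

text \<open>The subgroup \<open>{0, b, c, b + c}\<close> has index 2, so for \<open>x\<close>
  outside it \<open>\<theta> x\<close> or \<open>\<theta> x - x\<close> lies inside. The only values
  still free there are \<open>c\<close> and \<open>b\<close> respectively, which serve at most two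
  of the four such \<open>x\<close>.\<close>

lemma not_switchable_8:
  fixes a b c :: "'a::{field,finite}"
  assumes card: "CARD('a) = 8"
  shows "\<not> switchable \<theta> a b c"
proof
  assume "switchable \<theta> a b c"
  then obtain \<theta> and b c :: 'a where o: "orthomorphism \<theta>" and bc: "b \<noteq> 0" "c \<noteq> 0" "b \<noteq> c"
    and v: "\<theta> 0 = 0" "\<theta> b = b - c" "\<theta> c = b" by (rule switchable_at_0)
  have "CHAR('a) dvd 2 ^ 3" using CHAR_dvd_CARD[where 'a = 'a] card by simp
  hence "CHAR('a) = 2" by (metis prime_CHAR prime_dvd_power primes_dvd_imp_eq two_is_prime_nat)
  hence "(2::'a) = 0" by (metis of_nat_CHAR of_nat_numeral)
  hence self: "x + x = 0" for x :: 'a by (metis mult_2 mult_zero_left)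
  have minus: "x - y = x + y" for x y :: 'a using self by (metis add_diff_cancel_right' add.assoc add_0_right)
  have self': "x + (x + y) = y" for x y :: 'a using self by (metis add.assoc add_0)
  define H where "H = {0, b, c, b + c}"
  have H: "x + y \<in> H" if "x \<in> H" "y \<in> H" for x y
    using that by (auto simp: H_def self self' ac_simps)
  have "b + c \<noteq> 0" "b + c \<noteq> b" "b + c \<noteq> c" using bc minus by (metis eq_iff_diff_eq_0 add_cancel_right_right add_cancel_left_left)+
  hence card_H: "card H = 4" using bc by (simp add: H_def)
  have coset: "x + y \<in> H" if xy: "x \<notin> H" "y \<notin> H" for x y
  proof -
    have "card ((+) x ` H) = 4" using card_H by (simp add: card_image)
    moreover have disj: "H \<inter> (+) x ` H = {}"
    proof -
      have "x \<in> H" if "h \<in> H" "x + h \<in> H" for h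
        using H[OF that(2,1)] by (simp add: add.assoc self)
      thus ?thesis using xy by auto
    qed
    ultimately have "card (H \<union> (+) x ` H) = CARD('a)"
      using card_H card by (simp add: card_Un_disjoint)
    hence "y \<in> H \<union> (+) x ` H" by (metis UNIV_I card_eq_UNIV_imp_eq_UNIV finite)
    thus ?thesis using xy by (auto simp: self')
  qed
  have sub: "- H \<subseteq> {x. \<theta> x = c} \<union> {x. \<theta> x - x = b}"
  proof
    fix x assume x: "x \<in> - H"
    hence ne: "x \<noteq> 0" "x \<noteq> b" "x \<noteq> c" by (auto simp: H_def)
    have "\<theta> x \<noteq> \<theta> 0" "\<theta> x \<noteq> \<theta> b" "\<theta> x \<noteq> \<theta> c"
      "\<theta> x - x \<noteq> \<theta> 0 - 0" "\<theta> x - x \<noteq> \<theta> b - b" "\<theta> x - x \<noteq> \<theta> c - c"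
      using ne by (simp_all only: orthomorphismD[OF o] not_False_eq_True)
    hence n: "\<theta> x \<notin> {0, b, b + c}" "\<theta> x + x \<notin> {0, c, b + c}"
      using v by (auto simp: minus self self' ac_simps)
    show "x \<in> {x. \<theta> x = c} \<union> {x. \<theta> x - x = b}"
    proof (cases "\<theta> x \<in> H")
      case True
      thus ?thesis using n by (auto simp: H_def)
    next
      case False
      hence "\<theta> x + x \<in> H" using coset x by blast
      thus ?thesis using n by (auto simp: H_def minus)
    qed
  qed
  have le1: "card {x. h x = y} \<le> 1" if "\<And>x x'. h x = h x' \<longleftrightarrow> x = x'" for h :: "'a \<Rightarrow> 'a" and y
    using that by (auto simp: card_le_Suc0_iff_eq)
  have "card (- H) \<le> card {x. \<theta> x = c} + card {x. \<theta> x - x = b}"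
    using card_mono[OF _ sub] card_Un_le[of "{x. \<theta> x = c}" "{x. \<theta> x - x = b}"] by fastforce
  also have "\<dots> \<le> 1 + 1"
    by (intro add_mono le1 orthomorphismD[OF o])
  finally show False using card_H card by (simp add: Compl_eq_Diff_UNIV card_Diff_subset)
qed

section \<open>The classification\<close>

lemma CHAR_eq_CARD:
  assumes "range of_int = (UNIV :: 'a::{field,finite} set)"
  shows "CHAR('a) = CARD('a)"
proof (rule antisym)
  show "CHAR('a) \<le> CARD('a)"
    by (rule dvd_imp_le[OF CHAR_dvd_CARD]) simp
  have "x \<in> of_int ` {0..<int CHAR('a)}" for x :: 'a
  proof -
    obtain i where "x = of_int i" using assms by blast
    also have "\<dots> = of_int (i mod int CHAR('a))"
      by (simp add: of_int_eq_iff_cong_CHAR)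
    finally show ?thesis
      by (rule image_eqI) (use prime_gt_0_nat[OF prime_CHAR[where 'a = 'a]] in simp)
  qed
  hence "CARD('a) \<le> card ((of_int :: int \<Rightarrow> 'a) ` {0..<int CHAR('a)})"
    by (intro card_mono) auto
  also have "\<dots> \<le> CHAR('a)"
    using card_image_le[of "{0..<int CHAR('a)}" "of_int :: int \<Rightarrow> 'a"] by simp
  finally show "CARD('a) \<le> CHAR('a)" .
qed

lemma ex_switchable_prime:
  assumes char: "CHAR('a::{field,finite}) = CARD('a)" and card: "CARD('a) \<noteq> 2" "CARD('a) \<noteq> 5"
  shows "\<exists>\<theta> (a::'a) b c. switchable \<theta> a b c"
proof -
  have prime: "prime CARD('a)" using prime_CHAR[where 'a = 'a] char by simp
  have dvd: "d = CARD('a)" if "prime d" "d dvd CARD('a)" for d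
    using primes_dvd_imp_eq[OF that(1) prime that(2)] .
  have odd: "odd CARD('a)" using dvd[of 2] card by auto
  \<comment> \<open>The only prime divisible by 3 is 3, which is 3 modulo 4. Of the other odd
    classes modulo 24, the first two constructions miss just 5 and 17.\<close>
  have "CARD('a) mod 3 = 0 \<Longrightarrow> CARD('a) = 3" using dvd[of 3] by auto
  moreover have "n mod 3 = 0 \<or> n mod 3 = 1 \<or> n mod 4 = 3 \<or> n mod 24 = 5 \<or> n mod 24 = 17"
    if "odd n" for n :: nat
  proof -
    have "\<forall>r\<in>{..<24::nat}. odd r \<longrightarrow> r mod 3 = 0 \<or> r mod 3 = 1 \<or> r mod 4 = 3 \<or> r = 5 \<or> r = 17"
      by code_simp
    moreover have "n mod 24 mod 3 = n mod 3" "n mod 24 mod 4 = n mod 4" "odd (n mod 24)"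
      using that by (simp_all add: mod_mod_cancel dvd_mod_iff)
    ultimately show ?thesis by (metis lessThan_iff mod_less_divisor zero_less_numeral)
  qed
  ultimately consider "CARD('a) mod 3 = 1" | "CARD('a) mod 4 = 3"
    | "CARD('a) mod 24 = 5" | "CARD('a) mod 24 = 17"
    using odd by force
  thus ?thesis
  proof cases
    case 1
    thus ?thesis by (rule ex_switchable_1_mod_3)
  next
    case 2
    thus ?thesis by (rule ex_switchable_3_mod_4)
  next
    case 3
    define j where "j = int (CARD('a) div 24)"
    have "int CARD('a) = 24 * j + 5" "j \<ge> 1"
      using 3 card unfolding j_def by presburger+
    with char show ?thesis by (rule ex_switchable_prime_5_mod_24)
  next
    case 4
    define s where "s = int (CARD('a) div 8)"
    have "int CARD('a) = 8 * s + 1" "s \<ge> 2"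
      using 4 unfolding s_def by presburger+
    with char show ?thesis by (rule ex_switchable_prime_1_mod_8)
  qed
qed

theorem theorem3:
  fixes q :: nat
  assumes "primepow q"
    and "CARD('a::{field,finite}) = q"
  shows "(\<exists>f g :: 'a poly. orthomorphism_poly f \<and> orthomorphism_poly g \<and> hamming_dist f g = 3)
    \<longleftrightarrow> q \<notin> {2, 5, 8}"
  unfolding distance_3_iff_switchable
proof
  assume "\<exists>\<theta> (a::'a) b c. switchable \<theta> a b c"
  then obtain \<theta> and a b c :: 'a where s: "switchable \<theta> a b c" by blast
  have "card {a, b, c} \<le> CARD('a)" by (rule card_mono) auto
  hence "q \<noteq> 2" using s assms(2) by (auto simp: switchable_def)
  thus "q \<notin> {2, 5, 8}"
    using s not_switchable_5[where 'a = 'a] not_switchable_8[where 'a = 'a] assms(2) by auto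
next
  assume q: "q \<notin> {2, 5, 8}"
  \<comment> \<open>Characteristic 2, odd characteristic with an element outside the prime field, or
    a prime field.\<close>
  consider "(2::'a) = 0" | u where "(2::'a) \<noteq> 0" "(u::'a) \<notin> range of_int"
    | "range of_int = (UNIV :: 'a set)" by blast
  thus "\<exists>\<theta> (a::'a) b c. switchable \<theta> a b c"
  proof cases
    case 1
    thus ?thesis by (rule ex_switchable_char_2) (use q assms(2) in auto)
  next
    case 2
    thus ?thesis by (rule ex_switchable_extension)
  next
    case 3
    from CHAR_eq_CARD[OF this] show ?thesis
      by (rule ex_switchable_prime) (use q assms(2) in auto)
  qed
qed

end
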